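(* Consider trajectory data of the linear time-varying system $x_{t+1}=A_tx_t+B_tu_t+w_t$, and suppose that: (1) for every $t\in\mathbb{N}$ the pair $(A_t,B_t)$ is controllable; (2) $\|A_t\|\le a_m$, $\|B_t\|\le b_m$ and $\|w_t\|\le w_m$ for all $t\in\mathbb{N}$; (3) $\|[B_{t-1}-B_t,\ A_{t-1}-A_t]\|\le\delta$ for all $t\ge1$, where $\delta>0$; (4) $\underline{\sigma}\big(\tfrac1L\bar D_t\bar D_t^\top\big)\ge\gamma^2$ for all $t\ge t_0$, and the probing signal satisfies $\|e_t\|\le e_m$ for all $t\ge0$, where $\gamma>0$, $e_m>0$. Then, for all $t\ge t_0$, the normalized least-squares estimate $[\hat B_t,\hat A_t]=\arg\min_{B,A}\|\bar X_{t+1}-[B,A]\bar D_t\|_F$ satisfies $$\|[\hat B_t,\hat A_t]-[B_t,A_t]\|\le\frac{L\delta}{\gamma}+\frac{w_m}{\gamma}.$$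
   Context: $\|\cdot\|$ is the Euclidean norm of vectors and the spectral norm of matrices, $\|\cdot\|_F$ the Frobenius norm, $\underline{\sigma}(\cdot)$ the minimum singular value, $M^\dagger$ the Moore–Penrose pseudoinverse. $x_t\in\mathbb{R}^n$ is the state, $u_t\in\mathbb{R}^m$ the input, $w_t\in\mathbb{R}^n$ the process noise. The input has the form $u_t=K_tx_t+e_t$ with a gain $K_t\in\mathbb{R}^{m\times n}$ and a probing signal $e_t$ for $t\ge t_0$; samples before $t_0$ are offline data generated by the same system. The window length is an integer $L\ge m+n$, and $t_0\ge L$. For $t\ge t_0$, let $d_s=[u_s^\top,x_s^\top]^\top$, $n_s=\sqrt{1+\|d_s\|^2}$, $D_t=[d_{t-L},\dots,d_{t-1}]\in\mathbb{R}^{(m+n)\times L}$, $X_{t+1}=[x_{t-L+1},\dots,x_t]\in\mathbb{R}^{n\times L}$, $N_t=\mathrm{diag}(n_{t-L},\dots,n_{t-1})$, $\bar D_t=D_tN_t^{-1}$, $\bar X_{t+1}=X_{t+1}N_t^{-1}$. The minimizer is $[\hat B_t,\hat A_t]=\bar X_{t+1}\bar D_t^\dagger$. *)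

theory Defs
  imports "HOL-Analysis.Analysis"
begin

text \<open>
  The matrix type \<open>real^'c^'r\<close> has rows indexed by \<open>'r\<close> and columns by \<open>'c\<close>. Its library norm is
  the Euclidean norm of the vector of Euclidean norms of the rows, i.e. the Frobenius norm; the
  spectral norm is the operator norm of the induced linear map.
\<close>

abbreviation frobenius_norm :: "real^'c^'r \<Rightarrow> real"
  where "frobenius_norm M \<equiv> norm M"

abbreviation spectral_norm :: "real^'c^'r \<Rightarrow> real"
  where "spectral_norm M \<equiv> onorm ((*v) M)"

definition is_eigenvalue :: "real^'r^'r \<Rightarrow> real \<Rightarrow> bool"
  where "is_eigenvalue M c \<longleftrightarrow> (\<exists>v. v \<noteq> 0 \<and> M *v v = c *\<^sub>R v)"

text \<open>
  An \<open>r \<times> c\<close> matrix has \<open>min r c\<close> singular values, the square roots of the eigenvalues of the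
  smaller of its two Gram matrices. Multiplicities are irrelevant for the minimum.
\<close>

definition singular_values :: "real^'c^'r \<Rightarrow> real set"
  where "singular_values M =
    {s. s \<ge> 0 \<and> (if CARD('r) \<le> CARD('c) then is_eigenvalue (M ** transpose M) (s\<^sup>2)
                                        else is_eigenvalue (transpose M ** M) (s\<^sup>2))}"

definition min_singular_value :: "real^'c^'r \<Rightarrow> real"
  where "min_singular_value M = Min (singular_values M)"

text \<open>The four Penrose equations; they have exactly one solution for every real matrix.\<close>

definition pseudoinverse :: "real^'c^'r \<Rightarrow> real^'r^'c"
  where "pseudoinverse M = (THE P. M ** P ** M = M \<and> P ** M ** P = P
    \<and> transpose (M ** P) = M ** P \<and> transpose (P ** M) = P ** M)"

definition diag :: "('l \<Rightarrow> real) \<Rightarrow> real^'l^'l"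
  where "diag c = (\<chi> i j. if i = j then c i else 0)"

text \<open>Controllability of the time-invariant system \<open>z\<^sub>k\<^sub>+\<^sub>1 = A z\<^sub>k + B v\<^sub>k\<close>: any initial state can be
  steered to any final state in finitely many steps.\<close>

definition controllable :: "real^'n^'n \<Rightarrow> real^'m^'n \<Rightarrow> bool"
  where "controllable A B \<longleftrightarrow>
    (\<forall>z0 zf. \<exists>(T::nat) (v :: nat \<Rightarrow> real^'m) (z :: nat \<Rightarrow> real^'n).
       z 0 = z0 \<and> (\<forall>k<T. z (Suc k) = A *v z k + B *v v k) \<and> z T = zf)"

definition hcat :: "real^'m^'n \<Rightarrow> real^'p^'n \<Rightarrow> real^('m + 'p)^'n"
  where "hcat B A = (\<chi> i j. case j of Inl k \<Rightarrow> B $ i $ k | Inr k \<Rightarrow> A $ i $ k)"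

definition vstack :: "real^'m \<Rightarrow> real^'n \<Rightarrow> real^('m + 'n)"
  where "vstack u x = (\<chi> j. case j of Inl k \<Rightarrow> u $ k | Inr k \<Rightarrow> x $ k)"

text \<open>
  The columns of the data matrices are indexed by a finite linearly ordered type \<open>'l\<close>, whose
  cardinality is the window length \<open>L\<close>. Column \<open>i\<close> of the window at time \<open>t\<close> holds the sample
  taken at time \<open>t - L + p\<close>, where \<open>p \<in> {0..<L}\<close> is the position of \<open>i\<close> in the order. The natural
  subtraction is only meant for \<open>t \<ge> L\<close>.
\<close>

definition sample_time :: "nat \<Rightarrow> 'l::{finite,linorder} \<Rightarrow> nat"
  where "sample_time t i = t - CARD('l::{finite,linorder}) + card {j. j < i}"

definition sample :: "(nat \<Rightarrow> real^'m) \<Rightarrow> (nat \<Rightarrow> real^'n) \<Rightarrow> nat \<Rightarrow> real^('m + 'n)"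
  where "sample u x s = vstack (u s) (x s)"

definition normalizer :: "(nat \<Rightarrow> real^'m) \<Rightarrow> (nat \<Rightarrow> real^'n) \<Rightarrow> nat \<Rightarrow> real"
  where "normalizer u x s = sqrt (1 + (norm (sample u x s))\<^sup>2)"

definition data_D ::
    "(nat \<Rightarrow> real^'m) \<Rightarrow> (nat \<Rightarrow> real^'n) \<Rightarrow> nat \<Rightarrow> real^('l::{finite,linorder})^('m + 'n)"
  where "data_D u x t = (\<chi> r i. sample u x (sample_time t i) $ r)"

text \<open>The successor data matrix \<open>X\<^sub>t\<^sub>+\<^sub>1 = [x\<^sub>t\<^sub>-\<^sub>L\<^sub>+\<^sub>1, \<dots>, x\<^sub>t]\<close>.\<close>

definition data_X_succ :: "(nat \<Rightarrow> real^'n) \<Rightarrow> nat \<Rightarrow> real^('l::{finite,linorder})^'n"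
  where "data_X_succ x t = (\<chi> r i. x (sample_time t i + 1) $ r)"

definition data_N ::
    "(nat \<Rightarrow> real^'m) \<Rightarrow> (nat \<Rightarrow> real^'n) \<Rightarrow> nat \<Rightarrow> real^('l::{finite,linorder})^('l::{finite,linorder})"
  where "data_N u x t = diag (\<lambda>i. normalizer u x (sample_time t i))"

definition D_bar ::
    "(nat \<Rightarrow> real^'m) \<Rightarrow> (nat \<Rightarrow> real^'n) \<Rightarrow> nat \<Rightarrow> real^('l::{finite,linorder})^('m + 'n)"
  where "D_bar u x t = data_D u x t ** matrix_inv (data_N u x t)"

definition X_bar_succ ::
    "(nat \<Rightarrow> real^'m) \<Rightarrow> (nat \<Rightarrow> real^'n) \<Rightarrow> nat \<Rightarrow> real^('l::{finite,linorder})^'n"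
  where "X_bar_succ u x t = data_X_succ x t ** matrix_inv (data_N u x t)"

end

theory Submission
  imports Defs
begin

text \<open>
  Excitation makes the normalized data matrix \<open>D\<close> have full row rank, so \<open>D D\<^sup>\<dagger> = I\<close> and
  the estimation error is \<open>E D\<^sup>\<dagger>\<close>, where \<open>E\<close> is the residual of the normalized data under the
  current system matrices. A sample at most \<open>L\<close> steps old has drifted by at most \<open>L \<delta>\<close> times its
  norm, and the normalizer dominates both that norm and \<open>1\<close>; hence every column of \<open>E\<close> has norm
  at most \<open>L \<delta> + w\<^sub>m\<close> and \<open>\<parallel>E\<parallel> \<le> \<surd>L (L \<delta> + w\<^sub>m)\<close>. The factor \<open>\<surd>L\<close> cancels against
  \<open>\<parallel>D\<^sup>\<dagger>\<parallel> \<le> 1 / (\<surd>L \<gamma>)\<close>.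
\<close>

section \<open>Adjoints and matrix algebra\<close>

lemma inner_matrix_vector_transpose:
  fixes M :: "real^'c^'r"
  shows "(M *v y) \<bullet> x = y \<bullet> (transpose M *v x)"
  by (metis dot_lmul_matrix inner_commute transpose_matrix_vector)

text \<open>Right multiplications by \<open>D\<close> and by \<open>transpose D\<close> are adjoint
  for the Frobenius inner product; this turns the normal equations into orthogonality of the
  residual.\<close>

lemma frobenius_inner_mult_transpose:
  fixes R :: "real^'c^'r" and D :: "real^'c^'k"
  shows "R \<bullet> (N ** D) = (R ** transpose D) \<bullet> N"
proof -
  have "(\<Sum>j\<in>UNIV. R$i$j * (\<Sum>k\<in>UNIV. N$i$k * D$k$j)) = (\<Sum>k\<in>UNIV. (\<Sum>j\<in>UNIV. R$i$j * D$k$j) * N$i$k)" for i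
    unfolding sum_distrib_left sum_distrib_right
    by (subst sum.swap) (simp add: mult_ac)
  then show ?thesis
    by (simp add: inner_vec_def matrix_matrix_mult_def transpose_def)
qed

lemma bounded_linear_matrix_vector: "bounded_linear ((*v) (M :: real^'c^'r))"
  by (simp add: linear_linear)

lemma matrix_diff_rdistrib:
  fixes M N :: "real^'k^'r"
  shows "(M - N) ** D = M ** D - N ** D"
  by (simp add: vec_eq_iff matrix_matrix_mult_def left_diff_distrib sum_subtractf)

section \<open>Eigenvalues of symmetric matrices and the minimum singular value\<close>

text \<open>Eigenvectors for distinct eigenvalues are orthogonal, hence independent, so the
  dimension bounds their number.\<close>

lemma finite_eigenvalues_symmetric:
  fixes S :: "real^'r^'r"
  assumes sym: "transpose S = S"
  shows "finite {c. is_eigenvalue S c}"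
proof -
  obtain f where f: "\<And>c. is_eigenvalue S c \<Longrightarrow> f c \<noteq> 0 \<and> S *v f c = c *\<^sub>R f c"
    using that[of "\<lambda>c. SOME v. v \<noteq> 0 \<and> S *v v = c *\<^sub>R v"]
    unfolding is_eigenvalue_def by (metis (mono_tags, lifting) someI_ex)
  let ?E = "{c. is_eigenvalue S c}"
  have orth: "f c \<bullet> f d = 0" if "c \<in> ?E" "d \<in> ?E" "c \<noteq> d" for c d
  proof -
    have "(S *v f c) \<bullet> f d = f c \<bullet> (S *v f d)"
      using inner_matrix_vector_transpose[of S] sym by metis
    then have "(c - d) * (f c \<bullet> f d) = 0"
      using f that by (simp add: algebra_simps)
    then show ?thesis using that by simp
  qed
  have inj: "inj_on f ?E"
    by (rule inj_onI) (metis f inner_eq_zero_iff mem_Collect_eq orth)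
  have "pairwise orthogonal (f ` ?E)"
    using orth unfolding pairwise_def orthogonal_def by blast
  then have "independent (f ` ?E)"
    using f by (intro pairwise_orthogonal_independent) auto
  then have "finite (f ` ?E)"
    using independent_bound by blast
  then show ?thesis
    using inj finite_imageD by blast
qed

text \<open>\<open>Min\<close> is meaningful only on finite sets. Singular values are square roots
  of eigenvalues of Gram matrices, which are symmetric.\<close>

lemma finite_singular_values:
  fixes M :: "real^'c^'r"
  shows "finite (singular_values M)"
proof -
  let ?E = "{c. is_eigenvalue (M ** transpose M) c} \<union> {c. is_eigenvalue (transpose M ** M) c}"
  have "finite ?E"
    by (simp add: finite_eigenvalues_symmetric matrix_transpose_mul)
  then have "finite (sqrt ` ?E)" by (rule finite_imageI)
  moreover have "singular_values M \<subseteq> sqrt ` ?E"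
  proof
    fix s assume "s \<in> singular_values M"
    then have "s = sqrt (s\<^sup>2)" "s\<^sup>2 \<in> ?E"
      by (auto simp: singular_values_def split: if_splits)
    then show "s \<in> sqrt ` ?E" by blast
  qed
  ultimately show ?thesis by (rule finite_subset[rotated])
qed

text \<open>A minimiser of the Rayleigh quotient is an eigenvector: the shifted form is positive
  semidefinite and vanishes there, so its gradient vanishes as well.\<close>

lemma ex_eigenvalue_le_Rayleigh:
  fixes S :: "real^'r^'r"
  assumes sym: "transpose S = S"
  shows "\<exists>c. is_eigenvalue S c \<and> (\<forall>v. c * (norm v)\<^sup>2 \<le> v \<bullet> (S *v v))"
proof -
  have cont: "continuous_on (sphere 0 1) (\<lambda>v. v \<bullet> (S *v v))"
    by (intro continuous_intros linear_continuous_on bounded_linear_matrix_vector)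
  have ne: "sphere (0::real^'r) 1 \<noteq> {}" by simp
  obtain v0 where v0: "norm v0 = 1" and min: "\<And>y. norm y = 1 \<Longrightarrow> v0 \<bullet> (S *v v0) \<le> y \<bullet> (S *v y)"
    using continuous_attains_inf[OF compact_sphere ne cont] by auto
  define c where "c = v0 \<bullet> (S *v v0)"
  have low: "c * (norm v)\<^sup>2 \<le> v \<bullet> (S *v v)" for v
  proof (cases "v = 0")
    case False
    have "c \<le> ((1 / norm v) *\<^sub>R v) \<bullet> (S *v ((1 / norm v) *\<^sub>R v))"
      unfolding c_def using False by (intro min) simp
    also have "\<dots> = (v \<bullet> (S *v v)) / (norm v)\<^sup>2"
      by (simp add: matrix_vector_mult_scaleR power2_eq_square)
    finally show ?thesis using False by (simp add: field_simps)
  qed simp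
  \<comment> \<open>Half the gradient at \<open>v0\<close> of the shifted form; the goal is
    \<open>z = 0\<close>.\<close>
  define z where "z = S *v v0 - c *\<^sub>R v0"
  define q where "q = z \<bullet> (S *v z) - c * (norm z)\<^sup>2"
  have q0: "q \<ge> 0" unfolding q_def using low[of z] by simp
  have s: "z \<bullet> (S *v v0) = v0 \<bullet> (S *v z)"
    using inner_matrix_vector_transpose[of S v0 z] sym by (simp add: inner_commute)
  have zz: "(norm z)\<^sup>2 = z \<bullet> (S *v v0) - c * (z \<bullet> v0)"
    unfolding power2_norm_eq_inner by (subst (2) z_def) (simp add: inner_diff_right)
  \<comment> \<open>Expansion of the nonnegative shifted form along the line through
    \<open>v0\<close> in direction \<open>z\<close>; its value at \<open>v0\<close> is 0.\<close>
  have quad: "0 \<le> 2 * r * (norm z)\<^sup>2 + r\<^sup>2 * q" for r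
  proof -
    have "(v0 + r *\<^sub>R z) \<bullet> (S *v (v0 + r *\<^sub>R z)) - c * (norm (v0 + r *\<^sub>R z))\<^sup>2
      = 2 * r * (z \<bullet> (S *v v0) - c * (z \<bullet> v0)) + r\<^sup>2 * q + (c - c * (norm v0)\<^sup>2)"
      unfolding power2_norm_eq_inner q_def
      by (simp add: matrix_vector_right_distrib matrix_vector_mult_scaleR inner_add_left
          inner_add_right s c_def inner_commute[of v0 z] algebra_simps power2_eq_square)
    then show ?thesis using low[of "v0 + r *\<^sub>R z"] v0 zz by simp
  qed
  \<comment> \<open>Moving by \<open>- r\<close> turns \<open>quad\<close> into
    \<open>r\<^sup>2 * (q + 2) \<le> 0\<close>. The summand 1 keeps the denominator positive when
    \<open>q = 0\<close>.\<close>
  define r where "r = (norm z)\<^sup>2 / (q + 1)"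
  have r: "(norm z)\<^sup>2 = r * (q + 1)" using q0 by (simp add: r_def)
  have "r\<^sup>2 * (q + 2) \<le> 0"
    using quad[of "- r"] unfolding r by (simp add: algebra_simps power2_eq_square)
  moreover have "r\<^sup>2 * (q + 2) > 0" if "r \<noteq> 0" using that q0 by simp
  ultimately have "r = 0" by fastforce
  then have "z = 0" using r by simp
  then have "is_eigenvalue S c"
    unfolding is_eigenvalue_def using v0 z_def by (intro exI[of _ v0]) auto
  with low show ?thesis by blast
qed

text \<open>For symmetric \<open>S\<close> the singular values come from the eigenvalues of
  \<open>S ** S\<close>. Semidefiniteness makes the eigenvalue \<open>c\<close> below the Rayleigh
  quotient nonnegative, so \<open>c\<close> is itself a singular value and the minimum is at most
  \<open>c\<close>.\<close>

lemma min_singular_value_le_Rayleigh: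
  fixes S :: "real^'r^'r"
  assumes sym: "transpose S = S" and psd: "\<And>v. 0 \<le> v \<bullet> (S *v v)"
  shows "min_singular_value S * (norm v)\<^sup>2 \<le> v \<bullet> (S *v v)"
proof -
  obtain c where c: "is_eigenvalue S c" and low: "\<And>v. c * (norm v)\<^sup>2 \<le> v \<bullet> (S *v v)"
    using ex_eigenvalue_le_Rayleigh[OF sym] by blast
  obtain y where y: "y \<noteq> 0" "S *v y = c *\<^sub>R y"
    using c unfolding is_eigenvalue_def by blast
  have "0 \<le> c * (y \<bullet> y)" using psd[of y] y by simp
  moreover have "y \<bullet> y > 0" using y by simp
  ultimately have "c \<ge> 0" by (simp add: zero_le_mult_iff)
  moreover have "is_eigenvalue (S ** S) (c\<^sup>2)"
    unfolding is_eigenvalue_def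
    by (rule exI[of _ y])
      (simp add: y matrix_vector_mul_assoc[symmetric] matrix_vector_mult_scaleR power2_eq_square)
  ultimately have "c \<in> singular_values S"
    by (simp add: singular_values_def sym)
  then have "min_singular_value S \<le> c"
    unfolding min_singular_value_def by (simp add: finite_singular_values)
  then show ?thesis
    using low[of v] mult_right_mono[of _ c "(norm v)\<^sup>2"] by fastforce
qed

section \<open>The pseudoinverse at full row rank and least squares\<close>

text \<open>\<open>H\<close> is the inverse of a symmetric Gram matrix, hence symmetric, which
  yields the fourth Penrose equation. The description by \<open>THE\<close> also demands
  uniqueness.\<close>

lemma pseudoinverse_eq_right_inverse:
  fixes D :: "real^'c^'r"
  assumes H: "D ** transpose D ** H = mat 1"
  shows "pseudoinverse D = transpose D ** H"
proof -
  let ?G = "D ** transpose D" and ?P = "transpose D ** H"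
  have DP: "D ** ?P = mat 1" using H by (simp add: matrix_mul_assoc)
  have Gsym: "transpose ?G = ?G" by (simp add: matrix_transpose_mul)
  have "transpose H ** ?G = mat 1"
    using arg_cong[OF H, of transpose] Gsym by (metis matrix_transpose_mul transpose_mat)
  then have Hsym: "transpose H = H"
    by (metis H matrix_mul_assoc matrix_mul_lid matrix_mul_rid)
  have PD: "transpose (?P ** D) = ?P ** D"
    by (simp add: matrix_transpose_mul Hsym matrix_mul_assoc)
  show ?thesis
    unfolding pseudoinverse_def
  proof (rule the_equality)
    show "D ** ?P ** D = D \<and> ?P ** D ** ?P = ?P \<and> transpose (D ** ?P) = D ** ?P \<and> transpose (?P ** D) = ?P ** D"
      using DP PD by (simp add: matrix_mul_assoc[symmetric] transpose_mat)
  next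
    \<comment> \<open>The first Penrose equation and the right inverse \<open>?P\<close> force
      \<open>D ** Q = mat 1\<close>; symmetry of \<open>Q ** D\<close> then gives
      \<open>Q ** ?G = transpose D\<close>, and \<open>H\<close> cancels \<open>?G\<close>.\<close>
    fix Q assume Q: "D ** Q ** D = D \<and> Q ** D ** Q = Q \<and> transpose (D ** Q) = D ** Q \<and> transpose (Q ** D) = Q ** D"
    have "D ** Q = D ** Q ** (D ** ?P)" by (simp add: DP)
    also have "\<dots> = mat 1" using Q DP by (metis matrix_mul_assoc)
    finally have DQ: "D ** Q = mat 1" .
    have "Q ** ?G = transpose (D ** (Q ** D))"
      using Q by (metis matrix_mul_assoc matrix_transpose_mul)
    also have "\<dots> = transpose D" by (simp add: matrix_mul_assoc DQ)
    finally have "Q ** ?G = transpose D" .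
    then show "Q = ?P" by (metis H matrix_mul_assoc matrix_mul_rid)
  qed
qed

text \<open>The quadratic form of \<open>D ** transpose D\<close> at \<open>v\<close> is the squared
  norm of \<open>transpose D *v v\<close>, so coercivity leaves a trivial kernel, and an injective
  square matrix is invertible.\<close>

lemma ex_gram_right_inverse:
  fixes D :: "real^'c^'r"
  assumes "0 < c" and coercive: "\<And>v. c * norm v \<le> norm (transpose D *v v)"
  shows "\<exists>H. D ** transpose D ** H = mat 1"
proof -
  have "v = 0" if "D ** transpose D *v v = 0" for v
  proof -
    have "(norm (transpose D *v v))\<^sup>2 = (D *v (transpose D *v v)) \<bullet> v"
      unfolding power2_norm_eq_inner inner_matrix_vector_transpose ..
    also have "\<dots> = 0" using that by (simp only: matrix_vector_mul_assoc inner_zero_left)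
    finally have "norm (transpose D *v v) = 0" by simp
    then have "c * norm v \<le> 0" using coercive[of v] by simp
    then show "v = 0" using \<open>0 < c\<close> by (simp add: mult_le_0_iff)
  qed
  then have "inj ((*v) (D ** transpose D))"
    using matrix_left_invertible_ker matrix_left_invertible_injective by blast
  then show ?thesis
    using matrix_left_invertible_injective matrix_left_right_inverse by blast
qed

text \<open>The image \<open>p\<close> of \<open>v\<close> has the form
  \<open>transpose D *v y\<close> and satisfies \<open>D *v p = v\<close>. Hence |p|^2 = v . y \<le>
  |v| |y| \<le> |v| |p| / c, and one factor |p| cancels.\<close>

lemma pseudoinverse_norm_bound:
  fixes D :: "real^'c^'r"
  assumes "0 < c" and coercive: "\<And>v. c * norm v \<le> norm (transpose D *v v)"
  shows "norm (pseudoinverse D *v v) \<le> norm v / c"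
proof -
  obtain H where H: "D ** transpose D ** H = mat 1"
    using ex_gram_right_inverse[OF assms] by blast
  define y where "y = H *v v"
  define p where "p = transpose D *v y"
  have P: "pseudoinverse D *v v = p"
    unfolding pseudoinverse_eq_right_inverse[OF H] p_def y_def by (simp only: matrix_vector_mul_assoc)
  have "D *v p = v"
    unfolding p_def y_def by (simp only: matrix_vector_mul_assoc matrix_mul_assoc H matrix_vector_mul_lid)
  then have "(norm p)\<^sup>2 = v \<bullet> y"
    unfolding power2_norm_eq_inner using inner_matrix_vector_transpose[of D p y] p_def by simp
  also have "\<dots> \<le> norm v * norm y" by (rule norm_cauchy_schwarz)
  also have "\<dots> \<le> norm v * (norm p / c)"
    using coercive[of y] \<open>0 < c\<close> unfolding p_def[symmetric]
    by (intro mult_left_mono) (simp_all add: field_simps)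
  finally have "norm p * norm p \<le> norm p * (norm v / c)"
    by (simp add: power2_eq_square mult.commute)
  then have "norm p \<le> norm v / c"
    using \<open>0 < c\<close> by (cases "p = 0") (simp, metis mult_le_cancel_left_pos zero_less_norm_iff)
  then show ?thesis using P by simp
qed

text \<open>By the normal equations the residual at \<open>?M\<close> is orthogonal to every
  \<open>N ** D\<close>, so Pythagoras applies. Right invertibility of \<open>D\<close> makes the
  added term positive unless \<open>N = ?M\<close>, whence uniqueness.\<close>

lemma least_squares_unique_minimizer:
  fixes D :: "real^'c^'r" and X :: "real^'c^'n"
  assumes H: "D ** transpose D ** H = mat 1"
  shows "is_arg_min (\<lambda>M. frobenius_norm (X - M ** D)) (\<lambda>_. True) M \<longleftrightarrow> M = X ** pseudoinverse D"
proof -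
  let ?M = "X ** pseudoinverse D" and ?f = "\<lambda>M. frobenius_norm (X - M ** D)"
  have "H ** (D ** transpose D) = mat 1"
    using H matrix_left_right_inverse by blast
  then have "?M ** D ** transpose D = X ** transpose D"
    unfolding pseudoinverse_eq_right_inverse[OF H]
    by (metis matrix_mul_assoc matrix_mul_rid)
  then have zero: "(X - ?M ** D) ** transpose D = 0"
    by (simp add: matrix_diff_rdistrib)
  have less: "?f ?M < ?f N" if "N \<noteq> ?M" for N
  proof -
    have orth: "(X - ?M ** D) \<bullet> ((?M - N) ** D) = 0"
      unfolding frobenius_inner_mult_transpose zero by simp
    have split: "X - N ** D = (X - ?M ** D) + (?M - N) ** D"
      by (simp add: matrix_diff_rdistrib)
    have "(?f N)\<^sup>2 = (?f ?M)\<^sup>2 + (norm ((?M - N) ** D))\<^sup>2"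
      unfolding split using orth
      by (simp add: power2_norm_eq_inner inner_add_left inner_add_right inner_commute)
    moreover have "(?M - N) ** D \<noteq> 0"
    proof
      assume "(?M - N) ** D = 0"
      then have "(?M - N) ** (D ** transpose D ** H) = 0 ** transpose D ** H"
        by (metis matrix_mul_assoc)
      then have "?M - N = 0"
        unfolding H by simp
      then show False using that by simp
    qed
    ultimately have "(?f ?M)\<^sup>2 < (?f N)\<^sup>2" by simp
    then show ?thesis using power2_less_imp_less norm_ge_zero by blast
  qed
  then show ?thesis
    unfolding is_arg_min_def by (metis less_asym less_irrefl)
qed

section \<open>Norm bound by columns, diagonal and block matrices, the data window\<close>

text \<open>\<open>E *v y\<close> combines the columns with weights \<open>y$i\<close>, so
  \<open>c\<close> times the 1-norm of \<open>y\<close> bounds it; Cauchy-Schwarz converts to the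
  Euclidean norm at the cost of the root.\<close>

lemma norm_matrix_vector_le_columns:
  fixes E :: "real^'l^'n"
  assumes col: "\<And>i. norm (column i E) \<le> c"
  shows "norm (E *v y) \<le> sqrt (CARD('l)) * c * norm y"
proof -
  have c: "0 \<le> c" using col norm_ge_zero order_trans by blast
  have "norm (E *v y) \<le> (\<Sum>i\<in>UNIV. \<bar>y$i\<bar> * c)"
    unfolding matrix_mult_sum scalar_mult_eq_scaleR
    by (intro sum_norm_le) (simp add: col mult_left_mono)
  also have "\<dots> = (\<Sum>i\<in>UNIV. \<bar>y$i\<bar>) * c" by (simp add: sum_distrib_right)
  also have "\<dots> \<le> (sqrt (CARD('l)) * norm y) * c"
  proof (intro mult_right_mono c)
    have "(\<Sum>i\<in>UNIV. \<bar>y$i\<bar>)\<^sup>2 \<le> (\<Sum>i\<in>UNIV. \<bar>y$i\<bar>\<^sup>2) * CARD('l)"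
      by (rule sum_squared_le_sum_of_squares)
    also have "\<dots> = (sqrt (CARD('l)) * norm y)\<^sup>2"
      by (simp add: power_mult_distrib norm_vec_def L2_set_def sum_nonneg)
    finally show "(\<Sum>i\<in>UNIV. \<bar>y$i\<bar>) \<le> sqrt (CARD('l)) * norm y"
      by (rule power2_le_imp_le) simp
  qed
  finally show ?thesis by (simp add: mult_ac)
qed

lemma matrix_mult_diag_nth: "(M ** diag c) $ r $ i = M $ r $ i * c i"
proof -
  have "(M ** diag c) $ r $ i = (\<Sum>k\<in>UNIV. if k = i then M $ r $ k * c k else 0)"
    by (simp only: diag_def matrix_matrix_mult_def vec_lambda_beta) (rule sum.cong, auto)
  then show ?thesis by simp
qed

lemma matrix_inv_diag:
  assumes "\<And>i. c i \<noteq> 0"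
  shows "matrix_inv (diag c) = diag (\<lambda>i. 1 / c i)"
proof -
  have *: "diag c ** diag (\<lambda>i. 1 / c i) = mat 1"
    unfolding vec_eq_iff matrix_mult_diag_nth by (simp add: diag_def mat_def assms)
  \<comment> \<open>\<open>matrix_inv\<close> is a choice among two-sided inverses, so exhibiting
    one gives its defining property.\<close>
  have "diag c ** matrix_inv (diag c) = mat 1 \<and> matrix_inv (diag c) ** diag c = mat 1"
    unfolding matrix_inv_def by (rule someI_ex) (metis * matrix_left_right_inverse)
  with * show ?thesis
    by (metis matrix_mul_assoc matrix_mul_lid matrix_mul_rid)
qed

lemma hcat_diff: "hcat (B - B') (A - A') = hcat B A - hcat B' A'"
  by (simp add: hcat_def vec_eq_iff split: sum.split)

lemma hcat_mult_vstack:
  fixes B :: "real^'m^'n" and A :: "real^'p^'n"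
  shows "hcat B A *v vstack u x = B *v u + A *v x"
proof -
  have "(\<Sum>j\<in>UNIV. f j) = (\<Sum>k\<in>UNIV. f (Inl k)) + (\<Sum>k\<in>UNIV. f (Inr k))"
    for f :: "'m + 'p \<Rightarrow> real"
    using sum.Plus[of "UNIV :: 'm set" "UNIV :: 'p set" f] by simp
  then show ?thesis
    by (simp add: hcat_def vstack_def matrix_vector_mult_def vec_eq_iff)
qed

text \<open>With \<open>hcat_surj\<close>, this identifies pairs with matrices and so transfers
  uniqueness of the minimizer to pairs.\<close>

lemma hcat_inject: "hcat B A = hcat B' A' \<longleftrightarrow> B = B' \<and> A = A'"
proof
  assume *: "hcat B A = hcat B' A'"
  have "hcat B A $ i $ Inl j = hcat B' A' $ i $ Inl j" "hcat B A $ i $ Inr k = hcat B' A' $ i $ Inr k" for i j k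
    using * by simp_all
  then show "B = B' \<and> A = A'" by (simp add: hcat_def vec_eq_iff)
qed simp

lemma hcat_surj: "\<exists>B A. M = hcat B A"
  by (rule exI[of _ "\<chi> i j. M $ i $ Inl j"], rule exI[of _ "\<chi> i j. M $ i $ Inr j"])
    (simp add: hcat_def vec_eq_iff split: sum.split)

text \<open>The position of \<open>i\<close> runs from 0 to L - 1, so the age of a sample runs from
  L down to 1.\<close>

lemma sample_time_window:
  assumes "CARD('l::{finite,linorder}) \<le> t"
  shows "sample_time t (i::'l::{finite,linorder}) < t" "t \<le> sample_time t i + CARD('l::{finite,linorder})"
proof -
  have "card {j. j < i} < CARD('l::{finite,linorder})"
    by (intro psubset_card_mono) auto
  then show "sample_time t i < t" "t \<le> sample_time t i + CARD('l)"
    using assms by (auto simp: sample_time_def)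
qed

lemma normalizer_ge_one: "1 \<le> normalizer u x s"
  by (simp add: normalizer_def)

lemma norm_sample_le_normalizer: "norm (sample u x s) \<le> normalizer u x s"
  unfolding normalizer_def by (rule real_le_rsqrt) simp

lemma matrix_inv_data_N:
  "matrix_inv (data_N u x t :: real^('l::{finite,linorder})^('l::{finite,linorder}))
    = diag (\<lambda>i. 1 / normalizer u x (sample_time t i))"
  unfolding data_N_def
  by (rule matrix_inv_diag) (metis normalizer_ge_one not_one_le_zero)

text \<open>Sample and successor share the same scaling factor, so the dynamics survive
  normalization column by column.\<close>

lemma column_D_bar:
  fixes u :: "nat \<Rightarrow> real^'m" and x :: "nat \<Rightarrow> real^'n"
  shows "column i (D_bar u x t :: real^('l::{finite,linorder})^('m + 'n))
    = (1 / normalizer u x (sample_time t i)) *\<^sub>R sample u x (sample_time t i)"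
  unfolding D_bar_def matrix_inv_data_N
  by (simp add: vec_eq_iff column_def matrix_mult_diag_nth data_D_def)

lemma column_X_bar_succ:
  "column i (X_bar_succ u x t :: real^('l::{finite,linorder})^'n)
    = (1 / normalizer u x (sample_time t i)) *\<^sub>R x (sample_time t i + 1)"
  unfolding X_bar_succ_def matrix_inv_data_N
  by (simp add: vec_eq_iff column_def matrix_mult_diag_nth data_X_succ_def)

lemma column_mult: "column i (M ** D) = M *v column i D"
  by (simp add: vec_eq_iff column_def matrix_matrix_mult_def matrix_vector_mult_def)

lemma column_diff: "column i (M - N) = column i M - column i N"
  by (simp add: vec_eq_iff column_def)

section \<open>Parameter drift and excitation\<close>

text \<open>Telescoping over \<open>k\<close> one-step changes.\<close>

lemma variation_accumulate:
  fixes M :: "nat \<Rightarrow> real^'c^'r"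
  assumes step: "\<And>t. spectral_norm (M t - M (Suc t)) \<le> \<delta>"
  shows "norm ((M s - M (s + k)) *v v) \<le> real k * \<delta> * norm v"
proof (induction k)
  case (Suc k)
  have "(M s - M (s + Suc k)) *v v
    = (M s - M (s + k)) *v v + (M (s + k) - M (Suc (s + k))) *v v"
    by (simp add: matrix_vector_mult_diff_rdistrib)
  also have "norm \<dots> \<le> real k * \<delta> * norm v + \<delta> * norm v"
  proof (rule norm_triangle_mono[OF Suc.IH])
    have "norm ((M (s + k) - M (Suc (s + k))) *v v)
      \<le> spectral_norm (M (s + k) - M (Suc (s + k))) * norm v"
      by (rule onorm[OF bounded_linear_matrix_vector])
    also have "\<dots> \<le> \<delta> * norm v" by (intro mult_right_mono step) simp
    finally show "norm ((M (s + k) - M (Suc (s + k))) *v v) \<le> \<delta> * norm v" .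
  qed
  finally show ?case by (simp add: algebra_simps)
qed simp

text \<open>The quadratic form of the scaled Gram matrix is |\<open>transpose D *v v\<close>|^2 / L;
  the Rayleigh bound and a square root turn the averaging factor into the root of L.\<close>

lemma transpose_coercive_of_min_singular_value:
  fixes D :: "real^'c^'r"
  assumes "0 \<le> \<gamma>" and "\<gamma>\<^sup>2 \<le> min_singular_value ((1 / real CARD('c)) *\<^sub>R (D ** transpose D))"
  shows "sqrt (CARD('c)) * \<gamma> * norm v \<le> norm (transpose D *v v)"
proof -
  let ?S = "(1 / real CARD('c)) *\<^sub>R (D ** transpose D)"
  have quad: "v \<bullet> (?S *v v) = (norm (transpose D *v v))\<^sup>2 / CARD('c)" for v
  proof -
    have "v \<bullet> (?S *v v) = (v \<bullet> (D *v (transpose D *v v))) / CARD('c)"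
      by (simp only: scaleR_matrix_vector_assoc[symmetric] matrix_vector_mul_assoc) simp
    also have "v \<bullet> (D *v (transpose D *v v)) = (norm (transpose D *v v))\<^sup>2"
      unfolding power2_norm_eq_inner by (subst inner_commute) (rule inner_matrix_vector_transpose)
    finally show ?thesis .
  qed
  have "transpose ?S = ?S"
    by (simp add: transpose_scalar matrix_transpose_mul)
  then have "min_singular_value ?S * (norm v)\<^sup>2 \<le> v \<bullet> (?S *v v)"
    by (rule min_singular_value_le_Rayleigh) (simp only: quad, simp)
  then have "\<gamma>\<^sup>2 * (norm v)\<^sup>2 \<le> (norm (transpose D *v v))\<^sup>2 / CARD('c)"
    using mult_right_mono[OF assms(2), of "(norm v)\<^sup>2"] unfolding quad by simp
  then have "(sqrt (CARD('c)) * \<gamma> * norm v)\<^sup>2 \<le> (norm (transpose D *v v))\<^sup>2"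
    by (simp add: power_mult_distrib field_simps)
  then show ?thesis by (rule power2_le_imp_le) simp
qed

section \<open>Unique minimizer and estimation error\<close>

theorem lemma2:
  fixes A :: "nat \<Rightarrow> real^'n^'n" and B :: "nat \<Rightarrow> real^'m^'n"
    and K :: "nat \<Rightarrow> real^'n^'m"
    and x w :: "nat \<Rightarrow> real^'n" and u e :: "nat \<Rightarrow> real^'m"
    and Ahat :: "nat \<Rightarrow> real^'n^'n" and Bhat :: "nat \<Rightarrow> real^'m^'n"
    and a\<^sub>m b\<^sub>m w\<^sub>m e\<^sub>m \<delta> \<gamma> :: real and t\<^sub>0 :: nat
  assumes window: "CARD('l::{finite,linorder}) \<ge> CARD('m) + CARD('n)"
    and t0: "t\<^sub>0 \<ge> CARD('l::{finite,linorder})"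
    and dynamics: "\<forall>t. x (t + 1) = A t *v x t + B t *v u t + w t"
    and input: "\<forall>t\<ge>t\<^sub>0. u t = K t *v x t + e t"
    and controllable: "\<forall>t. controllable (A t) (B t)"
    and bounds: "\<forall>t. spectral_norm (A t) \<le> a\<^sub>m \<and> spectral_norm (B t) \<le> b\<^sub>m \<and> norm (w t) \<le> w\<^sub>m"
    and delta_pos: "\<delta> > 0"
    and variation: "\<forall>t\<ge>1. spectral_norm (hcat (B (t - 1) - B t) (A (t - 1) - A t)) \<le> \<delta>"
    and gamma_pos: "\<gamma> > 0" and e_pos: "e\<^sub>m > 0"
    and excitation: "\<forall>t\<ge>t\<^sub>0.
      min_singular_value ((1 / real CARD('l::{finite,linorder})) *\<^sub>R
        ((D_bar u x t :: real^('l::{finite,linorder})^('m + 'n)) ** transpose (D_bar u x t :: real^('l::{finite,linorder})^('m + 'n)))) \<ge> \<gamma>\<^sup>2"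
    and probing: "\<forall>t. norm (e t) \<le> e\<^sub>m"
    and estimate: "\<forall>t\<ge>t\<^sub>0. hcat (Bhat t) (Ahat t)
      = (X_bar_succ u x t :: real^('l::{finite,linorder})^'n) ** pseudoinverse (D_bar u x t :: real^('l::{finite,linorder})^('m + 'n))"
  shows "\<forall>t\<ge>t\<^sub>0.
    {(B', A'). is_arg_min
        (\<lambda>(B', A'). frobenius_norm ((X_bar_succ u x t :: real^('l::{finite,linorder})^'n) - hcat B' A' ** D_bar u x t))
        (\<lambda>_. True) (B', A')} = {(Bhat t, Ahat t)}
    \<and> spectral_norm (hcat (Bhat t) (Ahat t) - hcat (B t) (A t))
        \<le> real CARD('l::{finite,linorder}) * \<delta> / \<gamma> + w\<^sub>m / \<gamma>"
proof (intro allI impI conjI)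
  fix t assume "t\<^sub>0 \<le> t"
  with t0 have Lt: "CARD('l) \<le> t" by simp
  define D where "D = (D_bar u x t :: real^('l::{finite,linorder})^('m + 'n))"
  define X where "X = (X_bar_succ u x t :: real^('l::{finite,linorder})^'n)"
  define M where "M = (\<lambda>t. hcat (B t) (A t))"
  define c where "c = sqrt CARD('l) * \<gamma>"
  have c: "c > 0" unfolding c_def using gamma_pos by simp
  have coercive: "c * norm v \<le> norm (transpose D *v v)" for v
    unfolding c_def
    using excitation \<open>t\<^sub>0 \<le> t\<close> gamma_pos
    by (intro transpose_coercive_of_min_singular_value) (auto simp: D_def)
  obtain H where H: "D ** transpose D ** H = mat 1"
    using ex_gram_right_inverse[OF c coercive] by blast
  have hat: "hcat (Bhat t) (Ahat t) = X ** pseudoinverse D"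
    using estimate \<open>t\<^sub>0 \<le> t\<close> by (simp add: X_def D_def)

  \<comment> \<open>Every matrix is some \<open>hcat B' A'\<close>, so competing pairs and competing
    matrices are the same.\<close>
  have argmin: "is_arg_min (\<lambda>(B', A'). frobenius_norm (X - hcat B' A' ** D)) (\<lambda>_. True) (B', A')
    \<longleftrightarrow> is_arg_min (\<lambda>M. frobenius_norm (X - M ** D)) (\<lambda>_. True) (hcat B' A')" for B' A'
    unfolding is_arg_min_def by (auto, metis hcat_surj)
  show "{(B', A'). is_arg_min
        (\<lambda>(B', A'). frobenius_norm ((X_bar_succ u x t :: real^('l::{finite,linorder})^'n) - hcat B' A' ** D_bar u x t))
        (\<lambda>_. True) (B', A')} = {(Bhat t, Ahat t)}"
    unfolding X_def[symmetric] D_def[symmetric] argmin least_squares_unique_minimizer[OF H]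
      hat[symmetric] hcat_inject by auto

  define E where "E = X - M t ** D"
  define b where "b = real CARD('l) * \<delta> + w\<^sub>m"
  \<comment> \<open>Instantiating at \<open>Suc k\<close> makes the natural subtraction in
    \<open>variation\<close> exact.\<close>
  have step: "spectral_norm (M k - M (Suc k)) \<le> \<delta>" for k
    using variation[rule_format, of "Suc k"] unfolding M_def hcat_diff by simp
  have "norm (column i E) \<le> b" for i
  proof -
    define s where "s = sample_time t i"
    define d where "d = sample u x s"
    define \<nu> where "\<nu> = normalizer u x s"
    have \<nu>: "1 \<le> \<nu>" "norm d \<le> \<nu>"
      unfolding \<nu>_def d_def by (rule normalizer_ge_one norm_sample_le_normalizer)+
    \<comment> \<open>\<open>k\<close> is the age of the sample, hence the number of drift
      steps.\<close>
    obtain k where k: "t = s + k" "k \<le> CARD('l)"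
      using sample_time_window[OF Lt, of i] unfolding s_def
      by (metis add_le_cancel_left less_imp_add_positive)
    have "x (s + 1) = M s *v d + w s"
      unfolding M_def d_def sample_def hcat_mult_vstack using dynamics by (simp add: add.commute)
    \<comment> \<open>The residual column is drift acting on the sample plus noise.\<close>
    then have "column i E = (1 / \<nu>) *\<^sub>R ((M s - M t) *v d + w s)"
      unfolding E_def X_def D_def column_diff column_mult column_D_bar column_X_bar_succ
        s_def[symmetric] \<nu>_def[symmetric] d_def[symmetric]
      by (simp add: matrix_vector_mult_scaleR matrix_vector_mult_diff_rdistrib algebra_simps)
    then have "norm (column i E) = norm ((M s - M t) *v d + w s) / \<nu>"
      using \<nu> by simp
    also have "\<dots> \<le> (real k * \<delta> * norm d + w\<^sub>m) / \<nu>"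
      unfolding k(1) using \<nu> bounds
      by (intro divide_right_mono norm_triangle_mono variation_accumulate step) auto
    \<comment> \<open>Drift is enlarged through \<open>norm d \<le> \<nu>\<close> and noise through
      \<open>1 \<le> \<nu>\<close>, so that \<open>\<nu>\<close> cancels.\<close>
    also have "\<dots> \<le> (real CARD('l) * \<delta> * \<nu> + w\<^sub>m * \<nu>) / \<nu>"
    proof -
      have "0 \<le> w\<^sub>m" using bounds norm_ge_zero order_trans by blast
      then have "w\<^sub>m \<le> w\<^sub>m * \<nu>" using \<nu> by (simp add: mult_le_cancel_left1)
      then show ?thesis using \<nu> k delta_pos
        by (intro divide_right_mono add_mono mult_mono) auto
    qed
    also have "\<dots> = b" unfolding b_def using \<nu> by (simp add: field_simps)
    finally show ?thesis .
  qed
  note E = norm_matrix_vector_le_columns[of E, OF this]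
  have b: "0 \<le> b" using \<open>\<And>i. norm (column i E) \<le> b\<close> norm_ge_zero order_trans by blast

  \<comment> \<open>This allows writing \<open>M t\<close> as
    \<open>M t ** D ** pseudoinverse D\<close>, so the error factors through
    \<open>E\<close>.\<close>
  have "D ** pseudoinverse D = mat 1"
    unfolding pseudoinverse_eq_right_inverse[OF H] using H by (simp add: matrix_mul_assoc)
  then have "hcat (Bhat t) (Ahat t) - M t = E ** pseudoinverse D"
    unfolding hat E_def by (simp add: matrix_diff_rdistrib matrix_mul_assoc[symmetric])
  moreover have "spectral_norm (E ** pseudoinverse D) \<le> b / \<gamma>"
  proof (rule onorm_bound)
    show "0 \<le> b / \<gamma>" using b gamma_pos by simp
    fix v
    have "norm ((E ** pseudoinverse D) *v v) \<le> sqrt CARD('l) * b * norm (pseudoinverse D *v v)"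
      unfolding matrix_vector_mul_assoc[symmetric] by (rule E)
    also have "\<dots> \<le> sqrt CARD('l) * b * (norm v / c)"
      using b by (intro mult_left_mono pseudoinverse_norm_bound[OF c coercive]) auto
    \<comment> \<open>The root of L from the columns cancels the one in \<open>c\<close>.\<close>
    also have "\<dots> = b / \<gamma> * norm v" by (simp add: c_def)
    finally show "norm ((E ** pseudoinverse D) *v v) \<le> b / \<gamma> * norm v" .
  qed
  ultimately show "spectral_norm (hcat (Bhat t) (Ahat t) - hcat (B t) (A t))
        \<le> real CARD('l) * \<delta> / \<gamma> + w\<^sub>m / \<gamma>"
    unfolding M_def b_def by (simp add: add_divide_distrib)
qed

end
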